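(* Let $\mathbb{X}$ be a vector space and let $(V_n)_{n=1}^\infty$ be a strongly nested sequence of subsets of $\mathbb{X}$ that is a neighbourhood basis of the origin for a vector topology on $\mathbb{X}$. Then $\mathbb{X}$, endowed with this topology, is complete if and only if the series $\sum_{n=1}^\infty x_n$ converges in $\mathbb{X}$ for every sequence $(x_n)_{n=1}^\infty$ in $\mathbb{X}$ such that $x_n\in V_n$ for all $n\in\mathbb{N}$.
   Context: Vector spaces are over $\mathbb{F}$, the real or complex field, and vector topologies are assumed to be Hausdorff. A sequence $(V_n)_{n=1}^\infty$ of subsets of a vector space is strongly nested if $V_{n+1}+V_{n+1}\subseteq V_n$ for all $n\in\mathbb{N}$. A topological vector space is complete if every Cauchy net in it converges; for first-countable topological vector spaces this is equivalent to every Cauchy sequence being convergent. Neighbourhoods are not assumed to be open. *)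

theory Defs
  imports "HOL-Analysis.Analysis" "HOL-Library.Set_Algebras"
begin

text \<open>The scalar field has class \<open>real_normed_field\<close>, of which \<open>real\<close> and \<open>complex\<close> are
  instances; by the Gelfand-Mazur theorem these are the only ones up to isometric isomorphism.
  The vector space is a whole type, with a scalar multiplication satisfying the
  \<open>vector_space\<close> axioms. Sequences are indexed from 1: their value at 0 is irrelevant.\<close>

definition vector_topology ::
  "('f::real_normed_field \<Rightarrow> 'a::ab_group_add \<Rightarrow> 'a) \<Rightarrow> 'a topology \<Rightarrow> bool" where
  "vector_topology smul T \<longleftrightarrow>
     topspace T = UNIV \<and>
     Hausdorff_space T \<and>
     continuous_map (prod_topology T T) T (\<lambda>(x, y). x + y) \<and>
     continuous_map (prod_topology euclidean T) T (\<lambda>(c, x). smul c x)"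

definition neighbourhood :: "'a topology \<Rightarrow> 'a \<Rightarrow> 'a set \<Rightarrow> bool" where
  "neighbourhood T x U \<longleftrightarrow> (\<exists>W. openin T W \<and> x \<in> W \<and> W \<subseteq> U)"

definition neighbourhood_basis_seq :: "'a topology \<Rightarrow> 'a \<Rightarrow> (nat \<Rightarrow> 'a set) \<Rightarrow> bool" where
  "neighbourhood_basis_seq T x V \<longleftrightarrow>
     (\<forall>n\<ge>1. neighbourhood T x (V n)) \<and>
     (\<forall>U. neighbourhood T x U \<longrightarrow> (\<exists>n\<ge>1. V n \<subseteq> U))"

definition strongly_nested :: "(nat \<Rightarrow> 'a::ab_group_add set) \<Rightarrow> bool" where
  "strongly_nested V \<longleftrightarrow> (\<forall>n\<ge>1. V (n + 1) + V (n + 1) \<subseteq> V n)"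

definition directed_preorder :: "'i set \<Rightarrow> ('i \<Rightarrow> 'i \<Rightarrow> bool) \<Rightarrow> bool" where
  "directed_preorder D le \<longleftrightarrow>
     D \<noteq> {} \<and>
     (\<forall>i\<in>D. le i i) \<and>
     (\<forall>i\<in>D. \<forall>j\<in>D. \<forall>k\<in>D. le i j \<longrightarrow> le j k \<longrightarrow> le i k) \<and>
     (\<forall>i\<in>D. \<forall>j\<in>D. \<exists>k\<in>D. le i k \<and> le j k)"

definition net_converges ::
  "'a topology \<Rightarrow> 'i set \<Rightarrow> ('i \<Rightarrow> 'i \<Rightarrow> bool) \<Rightarrow> ('i \<Rightarrow> 'a) \<Rightarrow> 'a \<Rightarrow> bool" where
  "net_converges T D le x l \<longleftrightarrow>
     (\<forall>U. neighbourhood T l U \<longrightarrow> (\<exists>d\<in>D. \<forall>i\<in>D. le d i \<longrightarrow> x i \<in> U))"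

definition cauchy_net ::
  "'a::ab_group_add topology \<Rightarrow> 'i set \<Rightarrow> ('i \<Rightarrow> 'i \<Rightarrow> bool) \<Rightarrow> ('i \<Rightarrow> 'a) \<Rightarrow> bool" where
  "cauchy_net T D le x \<longleftrightarrow>
     (\<forall>U. neighbourhood T 0 U \<longrightarrow>
        (\<exists>d\<in>D. \<forall>i\<in>D. \<forall>j\<in>D. le d i \<longrightarrow> le d j \<longrightarrow> x i - x j \<in> U))"

text \<open>A definition cannot quantify over all index types of nets. Nets whose directed set
  consists of elements of \<open>'a set \<times> 'a\<close> suffice: every net has an equivalent one of this
  form, with index set the pairs of a tail of the net and a point of that tail. The lemma
  \<open>tvs_complete_all_nets\<close> below shows that completeness in this sense gives convergence of
  Cauchy nets over every index type.\<close>

definition tvs_complete :: "'a::ab_group_add topology \<Rightarrow> bool" where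
  "tvs_complete T \<longleftrightarrow>
     (\<forall>(D :: ('a set \<times> 'a) set) le x.
        directed_preorder D le \<longrightarrow> cauchy_net T D le x \<longrightarrow> (\<exists>l. net_converges T D le x l))"

lemma tvs_complete_all_nets:
  fixes T :: "'a::ab_group_add topology" and D :: "'i set"
  assumes "tvs_complete T" and D: "directed_preorder D le" and C: "cauchy_net T D le x"
  shows "\<exists>l. net_converges T D le x l"
proof -
  define tl where "tl d = x ` {i\<in>D. le d i}" for d
  define E where "E = {(tl d, x i) | d i. d \<in> D \<and> i \<in> D \<and> le d i}"
  define r :: "'a set \<times> 'a \<Rightarrow> 'a set \<times> 'a \<Rightarrow> bool" where "r p q \<longleftrightarrow> fst q \<subseteq> fst p" for p q
  have refl: "\<And>i. i \<in> D \<Longrightarrow> le i i"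
    and tr: "\<And>i j k. i \<in> D \<Longrightarrow> j \<in> D \<Longrightarrow> k \<in> D \<Longrightarrow> le i j \<Longrightarrow> le j k \<Longrightarrow> le i k"
    and dir: "\<And>i j. i \<in> D \<Longrightarrow> j \<in> D \<Longrightarrow> \<exists>k\<in>D. le i k \<and> le j k" and ne: "D \<noteq> {}"
    using D unfolding directed_preorder_def by blast+
  have E_ne: "(tl d, x d) \<in> E" if "d \<in> D" for d
    using that refl unfolding E_def by blast
  have "\<exists>s\<in>E. r p s \<and> r q s" if "p \<in> E" "q \<in> E" for p q
  proof -
    from that obtain d e where de: "d \<in> D" "e \<in> D" "fst p = tl d" "fst q = tl e"
      unfolding E_def by auto
    then obtain k where k: "k \<in> D" "le d k" "le e k" using dir by blast
    have "tl k \<subseteq> tl d" "tl k \<subseteq> tl e"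
      using k de tr unfolding tl_def by blast+
    then show ?thesis using E_ne[OF k(1)] de by (intro bexI[of _ "(tl k, x k)"]) (auto simp: r_def)
  qed
  then have "directed_preorder E r"
    unfolding directed_preorder_def using ne E_ne by (auto simp: r_def)
  moreover have "cauchy_net T E r snd"
    unfolding cauchy_net_def
  proof (intro allI impI)
    fix U assume "neighbourhood T 0 U"
    then obtain d where d: "d \<in> D" "\<forall>i\<in>D. \<forall>j\<in>D. le d i \<longrightarrow> le d j \<longrightarrow> x i - x j \<in> U"
      using C unfolding cauchy_net_def by blast
    have mem: "\<exists>i\<in>D. le d i \<and> snd p = x i" if "p \<in> E" "r (tl d, x d) p" for p
    proof -
      from that(1) obtain e i where "p = (tl e, x i)" "i \<in> D" "le e i" unfolding E_def by blast
      then have "snd p \<in> tl e" "fst p = tl e" by (auto simp: tl_def)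
      then have "snd p \<in> tl d" using that(2) by (auto simp: r_def)
      then show ?thesis by (auto simp: tl_def)
    qed
    show "\<exists>p\<in>E. \<forall>i\<in>E. \<forall>j\<in>E. r p i \<longrightarrow> r p j \<longrightarrow> snd i - snd j \<in> U"
    proof (intro bexI[of _ "(tl d, x d)"] ballI impI)
      show "(tl d, x d) \<in> E" by (rule E_ne[OF d(1)])
      fix p q assume "p \<in> E" "q \<in> E" "r (tl d, x d) p" "r (tl d, x d) q"
      then obtain i j where "i \<in> D" "le d i" "snd p = x i" "j \<in> D" "le d j" "snd q = x j"
        using mem by metis
      then show "snd p - snd q \<in> U" using d(2) by simp
    qed
  qed
  ultimately obtain l where l: "net_converges T E r snd l"
    using assms(1) unfolding tvs_complete_def by blast
  have "net_converges T D le x l"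
    unfolding net_converges_def
  proof (intro allI impI)
    fix U assume "neighbourhood T l U"
    then obtain p where p: "p \<in> E" "\<forall>q\<in>E. r p q \<longrightarrow> snd q \<in> U"
      using l unfolding net_converges_def by blast
    then obtain d where d: "d \<in> D" "fst p = tl d" unfolding E_def by auto
    have "x i \<in> U" if "i \<in> D" "le d i" for i
    proof -
      have "(tl d, x i) \<in> E" using that d unfolding E_def by blast
      then show ?thesis using p(2) d(2) by (auto simp: r_def)
    qed
    then show "\<exists>d\<in>D. \<forall>i\<in>D. le d i \<longrightarrow> x i \<in> U" using d by blast
  qed
  then show ?thesis ..
qed

definition series_converges :: "'a::ab_group_add topology \<Rightarrow> (nat \<Rightarrow> 'a) \<Rightarrow> bool" where
  "series_converges T x \<longleftrightarrow> (\<exists>s. limitin T (\<lambda>N. \<Sum>n=1..N. x n) s sequentially)"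

end

theory Submission
  imports Defs
begin

text \<open>Strong nestedness makes a tail \<open>x\<^sub>m\<^sub>+\<^sub>1 + \<dots> + x\<^sub>M\<close> of terms \<open>x\<^sub>n \<in> V\<^sub>n\<close> lie in \<open>V\<^sub>m\<close>, so
  the partial sums of such a series are Cauchy. Conversely, a Cauchy net has an increasing
  sequence of indices whose successive differences lie in \<open>V\<^sub>n\<close>; the telescoping series
  gives a limit along this sequence, and this is a limit of the whole net.\<close>

lemma neighbourhood_mem: "neighbourhood T a U \<Longrightarrow> a \<in> U"
  unfolding neighbourhood_def by blast

lemma neighbourhood_preimage:
  assumes f: "continuous_map S T f" and "a \<in> topspace S" "neighbourhood T (f a) U"
  shows "neighbourhood S a {x. f x \<in> U}"
proof -
  obtain W where W: "openin T W" "f a \<in> W" "W \<subseteq> U"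
    using assms(3) unfolding neighbourhood_def by blast
  have "openin S {x \<in> topspace S. f x \<in> W}"
    using f W(1) by (rule openin_continuous_map_preimage)
  then show ?thesis
    unfolding neighbourhood_def using W assms(2)
    by (intro exI[of _ "{x \<in> topspace S. f x \<in> W}"]) auto
qed

lemma neighbourhood_Int:
  "neighbourhood T a U \<Longrightarrow> neighbourhood T a W \<Longrightarrow> neighbourhood T a (U \<inter> W)"
  unfolding neighbourhood_def by (meson openin_Int Int_iff Int_mono)

text \<open>Bridges the library's \<open>limitin\<close>, which tests open sets, and neighbourhoods
  that need not be open: each of these contains an open set around the limit, and eventual
  membership passes to supersets.\<close>

lemma limitin_iff_neighbourhood:
  assumes "l \<in> topspace T"
  shows "limitin T f l F \<longleftrightarrow> (\<forall>U. neighbourhood T l U \<longrightarrow> (\<forall>\<^sub>F i in F. f i \<in> U))"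
proof (intro iffI allI impI)
  fix U assume "limitin T f l F" "neighbourhood T l U"
  then obtain W where "\<forall>\<^sub>F i in F. f i \<in> W" "W \<subseteq> U"
    unfolding limitin_def neighbourhood_def by blast
  then show "\<forall>\<^sub>F i in F. f i \<in> U"
    by (auto elim: eventually_mono)
next
  assume nb: "\<forall>U. neighbourhood T l U \<longrightarrow> (\<forall>\<^sub>F i in F. f i \<in> U)"
  have "neighbourhood T l U" if "openin T U" "l \<in> U" for U
    using that unfolding neighbourhood_def by blast
  then show "limitin T f l F"
    unfolding limitin_def using assms nb by simp
qed

lemma net_converges_sequentially_iff_limitin:
  assumes "l \<in> topspace T"
  shows "net_converges T UNIV (\<le>) f l \<longleftrightarrow> limitin T f l sequentially"
  unfolding limitin_iff_neighbourhood[OF assms] net_converges_def eventually_sequentially by simp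

lemma continuous_map_translation:
  assumes "vector_topology smul T"
  shows "continuous_map T T (\<lambda>x. x + a)"
proof -
  have "continuous_map T (prod_topology T T) (\<lambda>x. (x, a))"
    using assms by (auto simp: vector_topology_def intro!: continuous_intros)
  then have "continuous_map T T ((\<lambda>(x, y). x + y) \<circ> (\<lambda>x. (x, a)))"
    using assms unfolding vector_topology_def by (blast intro: continuous_map_compose)
  then show ?thesis by (simp add: o_def)
qed

text \<open>Negation is scalar multiplication by -1, so its continuity follows from that of
  \<open>smul\<close> with the scalar fixed.\<close>

lemma continuous_map_uminus:
  assumes "vector_space smul" and "vector_topology smul T"
  shows "continuous_map T T uminus"
proof -
  interpret vector_space smul by fact
  have "continuous_map T (prod_topology euclidean T) (\<lambda>x. (- 1, x))"
    by (auto intro!: continuous_intros)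
  then have "continuous_map T T ((\<lambda>(c, x). smul c x) \<circ> (\<lambda>x. (- 1, x)))"
    using assms unfolding vector_topology_def by (blast intro: continuous_map_compose)
  then show ?thesis by (simp add: o_def)
qed

text \<open>Translations by \<open>a\<close> and \<open>- a\<close> are continuous and mutually
  inverse, so each direction is a preimage under one of them. This carries the basis
  \<open>V\<close> at 0 to every other point.\<close>

lemma neighbourhood_translation_iff:
  assumes vt: "vector_topology smul T"
  shows "neighbourhood T a U \<longleftrightarrow> neighbourhood T 0 {v. v + a \<in> U}"
proof
  have top: "topspace T = UNIV" using vt by (simp add: vector_topology_def)
  show "neighbourhood T 0 {v. v + a \<in> U}" if "neighbourhood T a U"
    using neighbourhood_preimage[OF continuous_map_translation[OF vt, of a], of 0 U] that top by simp
  show "neighbourhood T a U" if "neighbourhood T 0 {v. v + a \<in> U}"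
    using neighbourhood_preimage[OF continuous_map_translation[OF vt, of "- a"],
        of a "{v. v + a \<in> U}"] that top
    by simp
qed

lemma strongly_nested_add_mem:
  assumes "strongly_nested V" "n \<ge> 1" "a \<in> V (Suc n)" "b \<in> V (Suc n)"
  shows "a + b \<in> V n"
  using assms unfolding strongly_nested_def by (auto intro: set_plus_intro)

text \<open>Adding 0, itself a member of \<open>V (Suc n)\<close>, to a point of
  \<open>V (Suc n)\<close> leads into \<open>V n\<close>.\<close>

lemma strongly_nested_antimono:
  assumes "strongly_nested V" "\<And>n. n \<ge> 1 \<Longrightarrow> 0 \<in> V n" "1 \<le> m" "m \<le> n"
  shows "V n \<subseteq> V m"
  using assms(4)
proof (induction n rule: dec_induct)
  case (step n)
  have "V (Suc n) \<subseteq> V n"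
    using strongly_nested_add_mem[OF assms(1), of n _ 0] assms(2,3) step.hyps by fastforce
  then show ?case using step.IH by blast
qed simp

text \<open>The induction splits off the first term, not the last: \<open>x (Suc m)\<close> and the
  remaining sum, by the hypothesis at \<open>Suc m\<close>, both lie in \<open>V (Suc m)\<close>, so
  their sum lies in \<open>V m\<close>. Hence \<open>m\<close> must stay arbitrary.\<close>

lemma strongly_nested_sum_mem:
  assumes sn: "strongly_nested V" and zero: "\<And>n. n \<ge> 1 \<Longrightarrow> 0 \<in> V n"
    and x: "\<And>n. n \<ge> 1 \<Longrightarrow> x n \<in> V n" and "m \<ge> 1"
  shows "(\<Sum>n = Suc m..m + k. x n) \<in> V m"
  using \<open>m \<ge> 1\<close>
proof (induction k arbitrary: m)
  case 0
  then show ?case using zero by simp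
next
  case (Suc k)
  have "(\<Sum>n = Suc m..m + Suc k. x n) = x (Suc m) + (\<Sum>n = Suc (Suc m)..Suc m + k. x n)"
    by (subst sum.atLeast_Suc_atMost) auto
  then show ?case
    using strongly_nested_add_mem[OF sn Suc.prems] x[of "Suc m"] Suc.IH[of "Suc m"] by simp
qed

lemma cauchy_net_partial_sums:
  assumes vs: "vector_space smul" and sn: "strongly_nested V" and vt: "vector_topology smul T"
    and nb: "neighbourhood_basis_seq T 0 V" and x: "\<And>n. n \<ge> 1 \<Longrightarrow> x n \<in> V n"
  shows "cauchy_net T UNIV (\<le>) (\<lambda>N. \<Sum>n=1..N. x n)"
  unfolding cauchy_net_def
proof (intro allI impI)
  fix U assume U: "neighbourhood T 0 U"
  let ?s = "\<lambda>N. \<Sum>n=1..N. x n"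
  have zero: "0 \<in> V n" if "n \<ge> 1" for n
    using nb that unfolding neighbourhood_basis_seq_def by (blast dest: neighbourhood_mem)
  \<comment> \<open>The Cauchy condition concerns differences in both orders, while
    \<open>V m\<close> may fail to be symmetric; so \<open>V m\<close> is chosen inside both
    \<open>U\<close> and its reflection.\<close>
  have "neighbourhood T 0 {v. - v \<in> U}"
    using neighbourhood_preimage[OF continuous_map_uminus[OF vs vt], of 0 U] U vt
    by (simp add: vector_topology_def)
  then obtain m where m: "m \<ge> 1" "V m \<subseteq> U \<inter> {v. - v \<in> U}"
    using nb neighbourhood_Int[OF U] unfolding neighbourhood_basis_seq_def by meson
  have step: "?s j - ?s i \<in> V i" if "1 \<le> i" "i \<le> j" for i j
  proof -
    have "?s j = ?s i + (\<Sum>n=Suc i..j. x n)"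
      using that sum.ub_add_nat[of 1 i x "j - i"] by simp
    moreover have "(\<Sum>n=Suc i..j. x n) \<in> V i"
      using strongly_nested_sum_mem[OF sn zero x that(1), of "j - i"] that by simp
    ultimately show ?thesis by simp
  qed
  have V: "?s j - ?s i \<in> U \<and> ?s i - ?s j \<in> U" if "m \<le> i" "i \<le> j" for i j
  proof -
    have "?s j - ?s i \<in> V m"
      using step[of i j] strongly_nested_antimono[OF sn zero m(1) that(1)] m(1) that by auto
    then show ?thesis using m(2) by fastforce
  qed
  show "\<exists>d\<in>UNIV. \<forall>i\<in>UNIV. \<forall>j\<in>UNIV. d \<le> i \<longrightarrow> d \<le> j \<longrightarrow> ?s i - ?s j \<in> U"
    using V nat_le_linear by (intro bexI[of _ m]) blast+
qed

text \<open>By dependent choice: the successor of \<open>d n\<close> is an upper bound of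
  \<open>d n\<close> and of an index beyond which all differences lie in
  \<open>V (Suc n)\<close>.\<close>

lemma cauchy_net_increasing_indices:
  assumes dp: "directed_preorder D le" and c: "cauchy_net T D le x"
    and nb: "\<And>n. n \<ge> 1 \<Longrightarrow> neighbourhood T 0 (V n)"
  obtains d :: "nat \<Rightarrow> 'i" where "\<And>n. d n \<in> D" "\<And>n. le (d n) (d (Suc n))"
    "\<And>n i j. n \<ge> 1 \<Longrightarrow> i \<in> D \<Longrightarrow> j \<in> D \<Longrightarrow> le (d n) i \<Longrightarrow> le (d n) j \<Longrightarrow> x i - x j \<in> V n"
proof -
  \<comment> \<open>At \<open>n = 0\<close> only membership in \<open>D\<close> is demanded, since
    nothing is known about \<open>V 0\<close>.\<close>
  define P where "P n d \<longleftrightarrow> d \<in> D \<and>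
    (n \<ge> 1 \<longrightarrow> (\<forall>i\<in>D. \<forall>j\<in>D. le d i \<longrightarrow> le d j \<longrightarrow> x i - x j \<in> V n))" for n :: nat and d
  have ne: "D \<noteq> {}"
    and tr: "\<And>i j k. i \<in> D \<Longrightarrow> j \<in> D \<Longrightarrow> k \<in> D \<Longrightarrow> le i j \<Longrightarrow> le j k \<Longrightarrow> le i k"
    and dir: "\<And>i j. i \<in> D \<Longrightarrow> j \<in> D \<Longrightarrow> \<exists>k\<in>D. le i k \<and> le j k"
    using dp unfolding directed_preorder_def by blast+
  have "\<exists>d. P 0 d" using ne by (simp add: P_def ex_in_conv)
  moreover have "\<exists>e. P (Suc n) e \<and> le d e" if "P n d" for n d
  proof -
    have d: "d \<in> D" using that by (simp add: P_def)
    obtain e where e: "e \<in> D" "\<forall>i\<in>D. \<forall>j\<in>D. le e i \<longrightarrow> le e j \<longrightarrow> x i - x j \<in> V (Suc n)"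
      using c nb[of "Suc n"] unfolding cauchy_net_def by auto
    obtain k where k: "k \<in> D" "le d k" "le e k"
      using dir[OF d e(1)] by blast
    \<comment> \<open>The tail beyond \<open>k\<close> is part of the tail beyond \<open>e\<close>,
      so \<open>k\<close> inherits the bound on differences.\<close>
    have "le e i" if "i \<in> D" "le k i" for i
      using tr[OF e(1) k(1) that(1) k(3) that(2)] .
    then have "P (Suc n) k" unfolding P_def using k(1) e(2) by blast
    then show ?thesis using k(2) by blast
  qed
  ultimately obtain d where "\<And>n. P n (d n)" "\<And>n. le (d n) (d (Suc n))"
    using dependent_nat_choice[of P "\<lambda>_. le"] by blast
  then show thesis using that unfolding P_def by blast
qed

lemma cauchy_net_converges:
  assumes sn: "strongly_nested V" and vt: "vector_topology smul T"
    and nb: "neighbourhood_basis_seq T 0 V"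
    and series: "\<And>x. (\<forall>n\<ge>1. x n \<in> V n) \<Longrightarrow> series_converges T x"
    and dp: "directed_preorder D le" and c: "cauchy_net T D le x"
  shows "\<exists>l. net_converges T D le x l"
proof -
  have top: "topspace T = UNIV" using vt by (simp add: vector_topology_def)
  have nbV: "neighbourhood T 0 (V n)" if "n \<ge> 1" for n
    using nb that unfolding neighbourhood_basis_seq_def by blast
  have zero: "0 \<in> V n" if "n \<ge> 1" for n
    using nbV[OF that] by (rule neighbourhood_mem)
  obtain d where d: "\<And>n. d n \<in> D" "\<And>n. le (d n) (d (Suc n))"
    "\<And>n i j. n \<ge> 1 \<Longrightarrow> i \<in> D \<Longrightarrow> j \<in> D \<Longrightarrow> le (d n) i \<Longrightarrow> le (d n) j \<Longrightarrow> x i - x j \<in> V n"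
    by (rule cauchy_net_increasing_indices[OF dp c, of V]) (use nbV in auto)
  have refl: "le i i" if "i \<in> D" for i
    using dp that unfolding directed_preorder_def by blast
  \<comment> \<open>Both \<open>d n\<close> and \<open>d (Suc n)\<close> lie beyond
    \<open>d n\<close>, the former by reflexivity.\<close>
  have "x (d (Suc n)) - x (d n) \<in> V n" if "n \<ge> 1" for n
    using d that refl by blast
  then have "series_converges T (\<lambda>n. x (d (Suc n)) - x (d n))"
    by (intro series) blast
  moreover have "(\<Sum>n=1..N. x (d (Suc n)) - x (d n)) = x (d (Suc N)) - x (d 1)" for N
    using sum_Suc_diff[of 1 N "\<lambda>n. x (d n)"] by simp
  ultimately obtain s where
    "limitin T (\<lambda>N. x (d (Suc N)) - x (d 1)) s sequentially"
    unfolding series_converges_def by auto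
  then have s: "\<forall>\<^sub>F N in sequentially. x (d (Suc N)) - x (d 1) \<in> U" if "neighbourhood T s U" for U
    using that by (simp add: limitin_iff_neighbourhood top)
  \<comment> \<open>The telescoped partial sums tend to \<open>s\<close>, so \<open>l\<close> is the
    limit of \<open>x (d (Suc N))\<close>.\<close>
  define l where "l = s + x (d 1)"
  have "net_converges T D le x l"
    unfolding net_converges_def
  proof (intro allI impI)
    fix U assume "neighbourhood T l U"
    then obtain m where m: "m \<ge> 1" "V m \<subseteq> {v. v + l \<in> U}"
      using nb unfolding neighbourhood_translation_iff[OF vt, of l] neighbourhood_basis_seq_def
      by blast
    \<comment> \<open>Two errors will be added, the distance of \<open>x i\<close> from
      \<open>x (d (Suc N))\<close> and that of the latter from \<open>l\<close>. Keeping each in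
      \<open>V (Suc m)\<close> puts their sum in \<open>V m\<close>.\<close>
    have "neighbourhood T s {v. v - s \<in> V (Suc m)}"
      unfolding neighbourhood_translation_iff[OF vt, of s] using nbV[of "Suc m"] by simp
    from s[OF this] obtain N0 where
      N0: "\<And>N. N \<ge> N0 \<Longrightarrow> x (d (Suc N)) - x (d 1) - s \<in> V (Suc m)"
      unfolding eventually_sequentially by blast
    \<comment> \<open>\<open>N0\<close> controls the partial sum, and \<open>m \<le> N\<close> gives
      \<open>V (Suc N) \<subseteq> V (Suc m)\<close> for the net.\<close>
    define N where "N = max N0 m"
    have "x i \<in> U" if i: "i \<in> D" "le (d (Suc N)) i" for i
    proof -
      have "x i - x (d (Suc N)) \<in> V (Suc N)"
        using d i refl by simp
      then have "x i - x (d (Suc N)) \<in> V (Suc m)"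
        using strongly_nested_antimono[OF sn zero, of "Suc m" "Suc N"] by (auto simp: N_def)
      moreover have "x (d (Suc N)) - x (d 1) - s \<in> V (Suc m)"
        using N0 by (simp add: N_def)
      ultimately have "(x i - x (d (Suc N))) + (x (d (Suc N)) - x (d 1) - s) \<in> V m"
        by (rule strongly_nested_add_mem[OF sn m(1)])
      then have "x i - l \<in> V m" by (simp add: l_def algebra_simps)
      then show ?thesis using m(2) by fastforce
    qed
    then show "\<exists>d\<in>D. \<forall>i\<in>D. le d i \<longrightarrow> x i \<in> U" using d(1) by blast
  qed
  then show ?thesis ..
qed

theorem theorem2p5:
  fixes smul :: "'f::real_normed_field \<Rightarrow> 'a::ab_group_add \<Rightarrow> 'a"
    and T :: "'a topology"
    and V :: "nat \<Rightarrow> 'a set"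
  assumes "vector_space smul"
    and "strongly_nested V"
    and "vector_topology smul T"
    and "neighbourhood_basis_seq T 0 V"
  shows "tvs_complete T \<longleftrightarrow>
    (\<forall>x :: nat \<Rightarrow> 'a. (\<forall>n\<ge>1. x n \<in> V n) \<longrightarrow> series_converges T x)"
proof
  assume complete: "tvs_complete T"
  have "series_converges T x" if x: "\<forall>n\<ge>1. x n \<in> V n" for x
  proof -
    have "directed_preorder (UNIV :: nat set) (\<le>)"
      unfolding directed_preorder_def by (auto intro: max.cobounded1 max.cobounded2)
    moreover have "cauchy_net T UNIV (\<le>) (\<lambda>N. \<Sum>n=1..N. x n)"
      using cauchy_net_partial_sums[OF assms] x by blast
    \<comment> \<open>\<open>tvs_complete\<close> quantifies over nets indexed by elements of
      \<open>'a set \<times> 'a\<close>; \<open>tvs_complete_all_nets\<close> transfers it to the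
      partial sums, indexed by naturals.\<close>
    ultimately show ?thesis
      using tvs_complete_all_nets[OF complete] assms(3)
      unfolding series_converges_def vector_topology_def
      by (metis net_converges_sequentially_iff_limitin UNIV_I)
  qed
  then show "\<forall>x. (\<forall>n\<ge>1. x n \<in> V n) \<longrightarrow> series_converges T x" by blast
next
  assume "\<forall>x. (\<forall>n\<ge>1. x n \<in> V n) \<longrightarrow> series_converges T x"
  then show "tvs_complete T"
    unfolding tvs_complete_def using cauchy_net_converges[OF assms(2-4)] by blast
qed

end
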